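(* Let $G$ and $H$ be finite simple graphs with at least $3$ vertices, let $\{G_i\}_{i\in I}$ and $\{H_i\}_{i\in I}$ be their single-vertex-deleted subgraphs, indexed by a common index set $I$, and suppose there are isomorphisms $\gamma_i:G_i\to H_i$ for all $i\in I$. Work in the category $\mathbf{StGrphs}$. Let $\kappa_i:H_i\to H$ be the inclusions and let $\Gamma:\coprod_{i\in I}G_i\to H$ be the morphism induced by the maps $\kappa_i\gamma_i$ via the universal property of the coproduct. Let $p_0,p_1:\coprod_{i\in I}G_i\times\coprod_{i\in I}G_i\to\coprod_{i\in I}G_i$ be the product projections and let $k:R_\Gamma\to \coprod_{i\in I}G_i\times\coprod_{i\in I}G_i$ be the equalizer of $\Gamma p_0$ and $\Gamma p_1$. Then $G$ is vertex-reconstructable if and only if there exists an epimorphism $\delta:\coprod_{i\in I}G_i\to G$ in $\mathbf{StGrphs}$ such that $\delta p_0k=\delta p_1k$.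
   Context: Here "$G$ is vertex-reconstructable" means, in this setting, that $G$ is isomorphic to $H$. A graph $X$ has vertex set $V(X)$, edge set $E(X)$ and incidence function $\psi_X$ assigning each edge an unordered pair of (not necessarily distinct) vertices; the part set is $P(X)=E(X)\cup V(X)$, and $\psi_X(v)=\{v,v\}$ for vertices. A strict graph morphism $f:X\to Y$ is a function $P(X)\to P(Y)$ mapping vertices to vertices and edges to edges with $\psi_Y(f(e))=\{f(x),f(y)\}$ whenever $\psi_X(e)=\{x,y\}$. $\mathbf{StGrphs}$ is the category of all graphs (multiple edges and loops allowed) with strict graph morphisms. The coproduct is disjoint union. The product $X\times Y$ has vertex set $V(X)\times V(Y)$ and, for edges $e\in E(X)$ with $\psi_X(e)=\{a_1,a_2\}$ and $f\in E(Y)$ with $\psi_Y(f)=\{b_1,b_2\}$, an edge $(e,f)$ with ends $(a_1,b_1),(a_2,b_2)$ and, if $a_1\ne a_2$ and $b_1\ne b_2$, a further edge $\overline{(e,f)}$ with ends $(a_1,b_2),(a_2,b_1)$; the projections send $(u,v)$, $(e,f)$, $\overline{(e,f)}$ to their first (resp. second) coordinate. The equalizer of $f,g:X\to Y$ is the inclusion of the subgraph of $X$ consisting of those parts $a$ with $f(a)=g(a)$ and $f(a_j)=g(a_j)$ for the ends $a_1,a_2$ of $a$. *)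

theory Defs
  imports Complex_Main "HOL-Library.Uprod"
begin

text \<open>
  Graphs with loops and multiple edges. Vertices and edges are kept in one type, so that a morphism
  is a single function on the part set, as in the category of graphs with strict morphisms.
\<close>

record 'a graph =
  verts :: "'a set"
  edges :: "'a set"
  inc :: "'a \<Rightarrow> 'a uprod"

definition is_graph :: "'a graph \<Rightarrow> bool" where
  "is_graph X \<longleftrightarrow> verts X \<inter> edges X = {} \<and> (\<forall>e\<in>edges X. set_uprod (inc X e) \<subseteq> verts X)"

definition parts :: "'a graph \<Rightarrow> 'a set" where
  "parts X = edges X \<union> verts X"

text \<open>The incidence function extended to all parts, with ends \<open>{v, v}\<close> for a vertex \<open>v\<close>.\<close>

definition ends :: "'a graph \<Rightarrow> 'a \<Rightarrow> 'a uprod" where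
  "ends X a = (if a \<in> verts X then Upair a a else inc X a)"

definition simple_graph :: "'a graph \<Rightarrow> bool" where
  "simple_graph X \<longleftrightarrow> is_graph X \<and> (\<forall>e\<in>edges X. proper_uprod (inc X e)) \<and> inj_on (inc X) (edges X)"

definition finite_graph :: "'a graph \<Rightarrow> bool" where
  "finite_graph X \<longleftrightarrow> finite (verts X) \<and> finite (edges X)"

text \<open>Only the values of a morphism on the parts of its domain matter.\<close>

definition hom :: "'a graph \<Rightarrow> 'b graph \<Rightarrow> ('a \<Rightarrow> 'b) \<Rightarrow> bool" where
  "hom X Y f \<longleftrightarrow>
     (\<forall>v\<in>verts X. f v \<in> verts Y) \<and> (\<forall>e\<in>edges X. f e \<in> edges Y) \<and>
     (\<forall>a\<in>parts X. \<forall>x y. ends X a = Upair x y \<longrightarrow> ends Y (f a) = Upair (f x) (f y))"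

definition eq_hom :: "'a graph \<Rightarrow> ('a \<Rightarrow> 'b) \<Rightarrow> ('a \<Rightarrow> 'b) \<Rightarrow> bool" where
  "eq_hom X f g \<longleftrightarrow> (\<forall>a\<in>parts X. f a = g a)"

definition graph_iso :: "'a graph \<Rightarrow> 'b graph \<Rightarrow> ('a \<Rightarrow> 'b) \<Rightarrow> bool" where
  "graph_iso X Y f \<longleftrightarrow> hom X Y f \<and> (\<exists>g. hom Y X g \<and> eq_hom X (g \<circ> f) id \<and> eq_hom Y (f \<circ> g) id)"

definition isomorphic :: "'a graph \<Rightarrow> 'b graph \<Rightarrow> bool" where
  "isomorphic X Y \<longleftrightarrow> (\<exists>f. graph_iso X Y f)"

text \<open>
  A definition cannot quantify over the types of the test objects. Letting them range over the graphs
  with parts in \<open>'b + 'b\<close> loses nothing, since two morphisms out of \<open>Y\<close> have a joint image with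
  at most that many parts: lemma \<open>epi_cancel\<close> below gives cancellation against graphs of any type.
\<close>

definition epi :: "'a graph \<Rightarrow> 'b graph \<Rightarrow> ('a \<Rightarrow> 'b) \<Rightarrow> bool" where
  "epi X Y f \<longleftrightarrow> hom X Y f \<and>
     (\<forall>(Z :: ('b + 'b) graph) g h. is_graph Z \<and> hom Y Z g \<and> hom Y Z h \<and> eq_hom X (g \<circ> f) (h \<circ> f)
        \<longrightarrow> eq_hom Y g h)"

definition delete_vertex :: "'a graph \<Rightarrow> 'a \<Rightarrow> 'a graph" where
  "delete_vertex X v =
     \<lparr>verts = verts X - {v}, edges = {e \<in> edges X. v \<notin> set_uprod (inc X e)}, inc = inc X\<rparr>"

definition vertex_deleted_subgraphs :: "'a graph \<Rightarrow> 'i set \<Rightarrow> ('i \<Rightarrow> 'a graph) \<Rightarrow> bool" where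
  "vertex_deleted_subgraphs X I Xs \<longleftrightarrow>
     (\<exists>v. bij_betw v I (verts X) \<and> (\<forall>i\<in>I. Xs i = delete_vertex X (v i)))"

definition coproduct :: "'i set \<Rightarrow> ('i \<Rightarrow> 'a graph) \<Rightarrow> ('i \<times> 'a) graph" where
  "coproduct I Xs =
     \<lparr>verts = (SIGMA i:I. verts (Xs i)), edges = (SIGMA i:I. edges (Xs i)),
      inc = (\<lambda>(i, e). map_uprod (Pair i) (inc (Xs i) e))\<rparr>"

definition coproj :: "'i \<Rightarrow> 'a \<Rightarrow> 'i \<times> 'a" where
  "coproj i a = (i, a)"

text \<open>\<open>VPair u v\<close> is the vertex \<open>(u, v)\<close>, \<open>EPair e f\<close> the edge \<open>(e, f)\<close>, \<open>EBar e f\<close> the further edge.\<close>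

datatype ('a, 'b) product_part = VPair 'a 'b | EPair 'a 'b | EBar 'a 'b

text \<open>
  Which of the two edges over \<open>(e, f)\<close> is the barred one depends on a labelling of the ends of \<open>e\<close>
  and \<open>f\<close> as first and second; an arbitrary labelling is fixed here.
\<close>

definition labelled_ends :: "'a graph \<Rightarrow> 'a \<Rightarrow> 'a \<times> 'a" where
  "labelled_ends X e = (SOME (x, y). inc X e = Upair x y)"

definition product :: "'a graph \<Rightarrow> 'b graph \<Rightarrow> ('a, 'b) product_part graph" where
  "product X Y =
     \<lparr>verts = {VPair u v | u v. u \<in> verts X \<and> v \<in> verts Y},
      edges = {EPair e f | e f. e \<in> edges X \<and> f \<in> edges Y} \<union>
              {EBar e f | e f. e \<in> edges X \<and> f \<in> edges Y \<and>
                 proper_uprod (inc X e) \<and> proper_uprod (inc Y f)},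
      inc = (\<lambda>p. case p of
          VPair u v \<Rightarrow> Upair (VPair u v) (VPair u v)
        | EPair e f \<Rightarrow> (let (a1, a2) = labelled_ends X e; (b1, b2) = labelled_ends Y f
                       in Upair (VPair a1 b1) (VPair a2 b2))
        | EBar e f \<Rightarrow> (let (a1, a2) = labelled_ends X e; (b1, b2) = labelled_ends Y f
                      in Upair (VPair a1 b2) (VPair a2 b1)))\<rparr>"

fun proj0 :: "('a, 'b) product_part \<Rightarrow> 'a" where
  "proj0 (VPair u v) = u"
| "proj0 (EPair e f) = e"
| "proj0 (EBar e f) = e"

fun proj1 :: "('a, 'b) product_part \<Rightarrow> 'b" where
  "proj1 (VPair u v) = v"
| "proj1 (EPair e f) = f"
| "proj1 (EBar e f) = f"

definition equalizer :: "'a graph \<Rightarrow> ('a \<Rightarrow> 'b) \<Rightarrow> ('a \<Rightarrow> 'b) \<Rightarrow> 'a graph" where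
  "equalizer X f g =
     (let S = {a \<in> parts X. f a = g a \<and> (\<forall>x \<in> set_uprod (ends X a). f x = g x)}
      in \<lparr>verts = verts X \<inter> S, edges = edges X \<inter> S, inc = inc X\<rparr>)"

text \<open>
  The remaining facts confirm that epimorphisms cancel against graphs of every type and that the
  constructions above have their universal properties.
\<close>

lemma ends_vert [simp]: "v \<in> verts X \<Longrightarrow> ends X v = Upair v v"
  by (simp add: ends_def)

lemma ends_edge [simp]: "is_graph X \<Longrightarrow> e \<in> edges X \<Longrightarrow> ends X e = inc X e"
  by (auto simp: ends_def is_graph_def)

lemma homI:
  assumes "is_graph X" "is_graph Y"
    and "\<And>v. v \<in> verts X \<Longrightarrow> f v \<in> verts Y" "\<And>e. e \<in> edges X \<Longrightarrow> f e \<in> edges Y"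
    and "\<And>e. e \<in> edges X \<Longrightarrow> inc Y (f e) = map_uprod f (inc X e)"
  shows "hom X Y f"
  unfolding hom_def using assms by (auto simp: parts_def)

lemma hom_inc:
  assumes "is_graph X" "is_graph Y" "hom X Y f" "e \<in> edges X"
  shows "inc Y (f e) = map_uprod f (inc X e)"
proof (cases "inc X e")
  case (Upair a b)
  then have "ends X e = Upair a b" using assms by simp
  then have "ends Y (f e) = Upair (f a) (f b)"
    using assms unfolding hom_def parts_def by blast
  moreover have "f e \<in> edges Y" using assms by (auto simp: hom_def)
  ultimately show ?thesis using Upair assms by simp
qed

lemma map_uprod_cong':
  "(\<And>x. x \<in> set_uprod p \<Longrightarrow> f x = g x) \<Longrightarrow> map_uprod f p = map_uprod g p"
  by (cases p) auto

lemma map_uprod_map_uprod: "map_uprod f (map_uprod g p) = map_uprod (f \<circ> g) p"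
  by (cases p) auto

lemma epi_cancel:
  fixes X :: "'a graph" and Y :: "'b graph" and Z :: "'c graph"
  assumes epi: "epi X Y f" and Y: "is_graph Y" and Z: "is_graph Z"
    and g: "hom Y Z g" and h: "hom Y Z h" and eq: "eq_hom X (g \<circ> f) (h \<circ> f)"
  shows "eq_hom Y g h"
proof -
  define W where "W = g ` parts Y \<union> h ` parts Y"
  define c :: "'c \<Rightarrow> 'b + 'b" where
    "c w = (if w \<in> g ` parts Y then Inl (inv_into (parts Y) g w) else Inr (inv_into (parts Y) h w))" for w
  have inj: "inj_on c W"
    by (rule inj_onI) (auto simp: W_def c_def split: if_splits dest: inv_into_injective)
  define d where "d = inv_into W c"
  have dc: "d (c w) = w" if "w \<in> W" for w
    using inj that by (simp add: d_def)
  define Z' where "Z' = \<lparr>verts = c ` (verts Z \<inter> W), edges = c ` {e \<in> edges Z \<inter> W. set_uprod (inc Z e) \<subseteq> W},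
    inc = (\<lambda>e. map_uprod c (inc Z (d e)))\<rparr>"
  have Z': "is_graph Z'"
    unfolding is_graph_def
  proof (intro conjI ballI)
    show "verts Z' \<inter> edges Z' = {}"
      using Z inj by (auto simp: Z'_def is_graph_def inj_on_def)
    fix e assume "e \<in> edges Z'"
    then obtain e' where e': "e = c e'" "e' \<in> edges Z" "e' \<in> W" "set_uprod (inc Z e') \<subseteq> W"
      by (auto simp: Z'_def)
    have "set_uprod (inc Z e') \<subseteq> verts Z" using Z e' by (auto simp: is_graph_def)
    then show "set_uprod (inc Z' e) \<subseteq> verts Z'"
      using e' dc by (cases "inc Z e'") (auto simp: Z'_def)
  qed
  have hom': "hom Y Z' (c \<circ> k)" if k: "hom Y Z k" and kW: "k ` parts Y \<subseteq> W" for k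
  proof (rule homI[OF Y Z'])
    show "(c \<circ> k) v \<in> verts Z'" if "v \<in> verts Y" for v
      using that k kW by (auto simp: Z'_def hom_def parts_def)
    fix e assume e: "e \<in> edges Y"
    have i: "inc Z (k e) = map_uprod k (inc Y e)" by (rule hom_inc[OF Y Z k e])
    have kw: "k e \<in> W" using e kW by (auto simp: parts_def)
    have s: "set_uprod (inc Y e) \<subseteq> verts Y" using Y e by (auto simp: is_graph_def)
    have "set_uprod (inc Z (k e)) \<subseteq> W"
      using s kW unfolding i by (cases "inc Y e") (auto simp: parts_def)
    then show "(c \<circ> k) e \<in> edges Z'"
      using k e kw by (auto simp: Z'_def hom_def)
    show "inc Z' ((c \<circ> k) e) = map_uprod (c \<circ> k) (inc Y e)"
      using kw by (simp add: Z'_def dc i map_uprod_map_uprod)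
  qed
  have "hom Y Z' (c \<circ> g)" "hom Y Z' (c \<circ> h)"
    using g h by (auto intro!: hom' simp: W_def)
  moreover have "eq_hom X ((c \<circ> g) \<circ> f) ((c \<circ> h) \<circ> f)"
    using eq by (auto simp: eq_hom_def)
  ultimately have "eq_hom Y (c \<circ> g) (c \<circ> h)"
    using epi Z' unfolding epi_def by blast
  then show ?thesis
    unfolding eq_hom_def W_def comp_def using inj_onD[OF inj] by (metis UnI1 UnI2 W_def image_eqI)
qed

lemma is_graph_delete_vertex: "is_graph X \<Longrightarrow> is_graph (delete_vertex X v)"
  by (auto simp: is_graph_def delete_vertex_def)

lemma is_graph_coproduct:
  assumes "\<And>i. i \<in> I \<Longrightarrow> is_graph (Xs i)"
  shows "is_graph (coproduct I Xs)"
proof -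
  have "set_uprod (map_uprod (Pair i) (inc (Xs i) e)) \<subseteq> (SIGMA i:I. verts (Xs i))"
    if "i \<in> I" "e \<in> edges (Xs i)" for i e
    using assms[OF that(1)] that by (cases "inc (Xs i) e") (auto simp: is_graph_def)
  then show ?thesis
    using assms by (fastforce simp: is_graph_def coproduct_def)
qed

lemma hom_coproj:
  assumes "\<And>i. i \<in> I \<Longrightarrow> is_graph (Xs i)" "i \<in> I"
  shows "hom (Xs i) (coproduct I Xs) (coproj i)"
  using assms(2) by (intro homI assms(1) is_graph_coproduct)
    (auto simp: coproduct_def coproj_def intro!: map_uprod_cong')

lemma coproduct_universal:
  assumes Xs: "\<And>i. i \<in> I \<Longrightarrow> is_graph (Xs i)" and Z: "is_graph Z"
    and fs: "\<And>i. i \<in> I \<Longrightarrow> hom (Xs i) Z (fs i)"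
  shows "\<exists>h. hom (coproduct I Xs) Z h \<and> (\<forall>i\<in>I. eq_hom (Xs i) (h \<circ> coproj i) (fs i)) \<and>
    (\<forall>h'. hom (coproduct I Xs) Z h' \<and> (\<forall>i\<in>I. eq_hom (Xs i) (h' \<circ> coproj i) (fs i)) \<longrightarrow>
       eq_hom (coproduct I Xs) h' h)"
proof -
  define h where "h = (\<lambda>(i, a). fs i a)"
  have "hom (coproduct I Xs) Z h"
  proof (rule homI[OF is_graph_coproduct[OF Xs] Z])
    show "h v \<in> verts Z" if "v \<in> verts (coproduct I Xs)" for v
      using that fs by (auto simp: coproduct_def h_def hom_def)
    show "h e \<in> edges Z" if "e \<in> edges (coproduct I Xs)" for e
      using that fs by (auto simp: coproduct_def h_def hom_def)
    fix e assume "e \<in> edges (coproduct I Xs)"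
    then obtain i e' where e: "e = (i, e')" "i \<in> I" "e' \<in> edges (Xs i)"
      by (auto simp: coproduct_def)
    then show "inc Z (h e) = map_uprod h (inc (coproduct I Xs) e)"
      using hom_inc[OF Xs Z fs] by (auto simp: coproduct_def h_def map_uprod_map_uprod intro!: map_uprod_cong')
  qed
  then show ?thesis
    by (intro exI[of _ h]) (auto simp: eq_hom_def parts_def coproduct_def coproj_def h_def)
qed

lemma inc_labelled_ends: "inc X e = Upair (fst (labelled_ends X e)) (snd (labelled_ends X e))"
proof -
  obtain x y where "inc X e = Upair x y" by (cases "inc X e")
  then have "\<exists>p. case p of (x, y) \<Rightarrow> inc X e = Upair x y" by auto
  from someI_ex[OF this] show ?thesis by (auto simp: labelled_ends_def split: prod.splits)
qed

lemma labelled_ends_verts: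
  "is_graph X \<Longrightarrow> e \<in> edges X \<Longrightarrow>
     fst (labelled_ends X e) \<in> verts X \<and> snd (labelled_ends X e) \<in> verts X"
  using inc_labelled_ends[of X e] by (auto simp: is_graph_def)

lemma is_graph_product:
  assumes "is_graph X" "is_graph Y"
  shows "is_graph (product X Y)"
  using labelled_ends_verts[OF assms(1)] labelled_ends_verts[OF assms(2)]
  by (auto simp: is_graph_def product_def Let_def case_prod_beta)

lemma hom_proj:
  assumes "is_graph X" "is_graph Y"
  shows "hom (product X Y) X proj0" "hom (product X Y) Y proj1"
  by (intro homI is_graph_product assms;
      auto simp: product_def Let_def case_prod_beta inc_labelled_ends[of X] inc_labelled_ends[of Y])+

lemma product_universal:
  assumes X: "is_graph X" and Y: "is_graph Y" and Z: "is_graph Z"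
    and f: "hom Z X f" and g: "hom Z Y g"
  shows "\<exists>h. hom Z (product X Y) h \<and> eq_hom Z (proj0 \<circ> h) f \<and> eq_hom Z (proj1 \<circ> h) g \<and>
    (\<forall>h'. hom Z (product X Y) h' \<and> eq_hom Z (proj0 \<circ> h') f \<and> eq_hom Z (proj1 \<circ> h') g \<longrightarrow> eq_hom Z h' h)"
proof -
  let ?P = "product X Y"
  have P: "is_graph ?P" by (rule is_graph_product[OF X Y])
  define pv where "pv x = VPair (f x) (g x)" for x
  define ok where "ok e p \<longleftrightarrow> p \<in> edges ?P \<and> proj0 p = f e \<and> proj1 p = g e \<and>
    inc ?P p = map_uprod pv (inc Z e)" for e p
  have ex: "\<exists>!p. ok e p" if e: "e \<in> edges Z" for e
  proof -
    obtain x y where xy: "inc Z e = Upair x y" by (cases "inc Z e")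
    have fe: "f e \<in> edges X" and ge: "g e \<in> edges Y" using e f g by (auto simp: hom_def)
    obtain a1 a2 where a: "labelled_ends X (f e) = (a1, a2)" by fastforce
    obtain b1 b2 where b: "labelled_ends Y (g e) = (b1, b2)" by fastforce
    have ia: "inc X (f e) = Upair a1 a2" and ib: "inc Y (g e) = Upair b1 b2"
      using inc_labelled_ends[of X "f e"] inc_labelled_ends[of Y "g e"] a b by auto
    have ia': "inc X (f e) = Upair (f x) (f y)" and ib': "inc Y (g e) = Upair (g x) (g y)"
      using hom_inc[OF Z X f e] hom_inc[OF Z Y g e] xy by auto
    have ok_iff: "ok e p \<longleftrightarrow>
        p = EPair (f e) (g e) \<and> Upair (VPair a1 b1) (VPair a2 b2) = Upair (pv x) (pv y) \<or>
        p = EBar (f e) (g e) \<and> a1 \<noteq> a2 \<and> b1 \<noteq> b2 \<and>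
          Upair (VPair a1 b2) (VPair a2 b1) = Upair (pv x) (pv y)" for p
      using fe ge by (cases p) (auto simp: ok_def product_def a b ia ib xy)
    have "ok e (EPair (f e) (g e)) \<or> ok e (EBar (f e) (g e))"
      using ia ia' ib ib' unfolding ok_iff by (auto simp: pv_def)
    moreover have "\<not> (ok e (EPair (f e) (g e)) \<and> ok e (EBar (f e) (g e)))"
      unfolding ok_iff by (auto simp: pv_def)
    ultimately show ?thesis
      using ok_iff by metis
  qed
  define h where "h z = (if z \<in> verts Z then pv z else (THE p. ok z p))" for z
  have hv: "h v = pv v" if "v \<in> verts Z" for v using that by (simp add: h_def)
  have he: "ok e (h e)" if "e \<in> edges Z" for e
    using theI'[OF ex[OF that]] that Z by (auto simp: h_def is_graph_def)
  have hv_inc: "map_uprod h' (inc Z e) = map_uprod pv (inc Z e)"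
    if "e \<in> edges Z" "\<And>v. v \<in> verts Z \<Longrightarrow> h' v = pv v" for e h'
    using that Z by (intro map_uprod_cong') (auto simp: is_graph_def)
  have "hom Z ?P h"
  proof (rule homI[OF Z P])
    show "h v \<in> verts ?P" if "v \<in> verts Z" for v
      using that f g by (auto simp: hv pv_def product_def hom_def)
  qed (use he hv_inc[OF _ hv] in \<open>auto simp: ok_def\<close>)
  moreover have "eq_hom Z (proj0 \<circ> h) f" "eq_hom Z (proj1 \<circ> h) g"
    using he hv by (auto simp: eq_hom_def parts_def ok_def pv_def)
  moreover have "eq_hom Z h' h"
    if h': "hom Z ?P h'" and p0: "eq_hom Z (proj0 \<circ> h') f" and p1: "eq_hom Z (proj1 \<circ> h') g" for h'
  proof -
    have v: "h' v = pv v" if "v \<in> verts Z" for v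
    proof -
      have "h' v \<in> verts ?P" "proj0 (h' v) = f v" "proj1 (h' v) = g v"
        using that h' p0 p1 by (auto simp: hom_def eq_hom_def parts_def)
      then show ?thesis by (auto simp: product_def pv_def)
    qed
    have "ok e (h' e)" if e: "e \<in> edges Z" for e
      using hom_inc[OF Z P h' e] hv_inc[OF e v] h' p0 p1 e
      by (auto simp: ok_def hom_def eq_hom_def parts_def)
    then have "h' e = h e" if "e \<in> edges Z" for e
      using ex[OF that] he[OF that] that by blast
    then show ?thesis using v hv by (auto simp: eq_hom_def parts_def)
  qed
  ultimately show ?thesis by blast
qed

lemma is_graph_equalizer:
  assumes "is_graph X"
  shows "is_graph (equalizer X f g)"
  using assms by (fastforce simp: is_graph_def equalizer_def Let_def parts_def ends_def)

lemma hom_equalizer: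
  assumes "is_graph X"
  shows "hom (equalizer X f g) X id" "eq_hom (equalizer X f g) (f \<circ> id) (g \<circ> id)"
proof -
  have "map_uprod id p = p" for p :: "'a uprod" by (cases p) auto
  then show "hom (equalizer X f g) X id"
    by (intro homI is_graph_equalizer assms) (auto simp: equalizer_def Let_def)
  show "eq_hom (equalizer X f g) (f \<circ> id) (g \<circ> id)"
    by (auto simp: eq_hom_def equalizer_def Let_def parts_def)
qed

lemma equalizer_universal:
  assumes X: "is_graph X" and Z: "is_graph Z" and h: "hom Z X h" and eq: "eq_hom Z (f \<circ> h) (g \<circ> h)"
  shows "\<exists>u. hom Z (equalizer X f g) u \<and> eq_hom Z (id \<circ> u) h \<and>
    (\<forall>u'. hom Z (equalizer X f g) u' \<and> eq_hom Z (id \<circ> u') h \<longrightarrow> eq_hom Z u' u)"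
proof -
  have "hom Z (equalizer X f g) h"
  proof (rule homI[OF Z is_graph_equalizer[OF X]])
    show "h v \<in> verts (equalizer X f g)" if "v \<in> verts Z" for v
      using that h eq by (auto simp: equalizer_def Let_def hom_def eq_hom_def parts_def)
    fix e assume e: "e \<in> edges Z"
    have i: "inc X (h e) = map_uprod h (inc Z e)" by (rule hom_inc[OF Z X h e])
    have hE: "h e \<in> edges X" using h e by (auto simp: hom_def)
    have s: "set_uprod (inc Z e) \<subseteq> verts Z" using Z e by (auto simp: is_graph_def)
    have "\<forall>x \<in> set_uprod (ends X (h e)). f x = g x"
      using s eq hE X by (cases "inc Z e") (auto simp: i eq_hom_def parts_def)
    then show "h e \<in> edges (equalizer X f g)"
      using hE eq e by (auto simp: equalizer_def Let_def eq_hom_def parts_def)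
    show "inc (equalizer X f g) (h e) = map_uprod h (inc Z e)"
      using i by (simp add: equalizer_def Let_def)
  qed
  then show ?thesis by (intro exI[of _ h]) (auto simp: eq_hom_def)
qed

end

theory Submission
  imports Defs
begin

text \<open>
  Epimorphisms of graphs are the morphisms that are surjective on parts, and \<open>\<Gamma>\<close> is one because every
  vertex and every edge of \<open>H\<close> survives the deletion of some third vertex. The graph \<open>R\<close> is the kernel
  pair of \<open>\<Gamma>\<close>, so \<open>\<delta>\<close> coequalizes its legs iff \<open>\<delta>\<close> factors as \<open>\<epsilon> \<circ> \<Gamma>\<close> with \<open>\<epsilon> : H \<rightarrow> G\<close>.
  Such an \<open>\<epsilon>\<close> is surjective, hence injective on vertices since \<open>G\<close> and \<open>H\<close> both have \<open>|I|\<close> of them,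
  and then injective on edges because \<open>H\<close> is simple. Conversely an isomorphism \<open>\<epsilon>\<close> gives
  the epimorphism \<open>\<epsilon> \<circ> \<Gamma>\<close>.
\<close>

section \<open>Surjective morphisms and epimorphisms\<close>

lemma hom_parts: "hom X Y f \<Longrightarrow> a \<in> parts X \<Longrightarrow> f a \<in> parts Y"
  by (auto simp: hom_def parts_def)

lemma hom_comp:
  assumes "is_graph X" "is_graph Y" "is_graph Z" "hom X Y f" "hom Y Z g"
  shows "hom X Z (g \<circ> f)"
proof (rule homI[OF assms(1,3)])
  fix e assume e: "e \<in> edges X"
  then have "f e \<in> edges Y" using assms by (auto simp: hom_def)
  then show "inc Z ((g \<circ> f) e) = map_uprod (g \<circ> f) (inc X e)"
    using hom_inc[OF assms(1,2,4) e] hom_inc[OF assms(2,3,5)] by (simp add: map_uprod_map_uprod)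
qed (use assms in \<open>auto simp: hom_def\<close>)

text \<open>A morphism preserves the kind of a part, and vertices and edges of \<open>Y\<close> are
  disjoint, so a preimage of a vertex cannot be an edge.\<close>

lemma surj_hom_verts:
  assumes "is_graph Y" "hom X Y f" "f ` parts X = parts Y"
  shows "f ` verts X = verts Y"
proof
  show "f ` verts X \<subseteq> verts Y" using assms by (auto simp: hom_def)
  show "verts Y \<subseteq> f ` verts X"
  proof
    fix v assume v: "v \<in> verts Y"
    then obtain a where "a \<in> parts X" "v = f a" using assms(3) by (auto simp: parts_def)
    with v assms show "v \<in> f ` verts X"
      by (auto simp: parts_def hom_def is_graph_def)
  qed
qed

lemma surj_hom_edges:
  assumes "is_graph Y" "hom X Y f" "f ` parts X = parts Y"
  shows "f ` edges X = edges Y"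
proof
  show "f ` edges X \<subseteq> edges Y" using assms by (auto simp: hom_def)
  show "edges Y \<subseteq> f ` edges X"
  proof
    fix e assume e: "e \<in> edges Y"
    then obtain a where "a \<in> parts X" "e = f a" using assms(3) by (auto simp: parts_def)
    with e assms show "e \<in> f ` edges X"
      by (auto simp: parts_def hom_def is_graph_def)
  qed
qed

lemma surj_hom_imp_epi:
  assumes "hom X Y f" "f ` parts X = parts Y"
  shows "epi X Y f"
  using assms unfolding epi_def eq_hom_def by (metis (no_types, lifting) comp_apply imageE)

text \<open>
  The test object glues two copies of \<open>Y\<close> along the image of \<open>f\<close>; the two inclusions agree
  exactly on that image.
\<close>

lemma epi_imp_surj:
  fixes X :: "'a graph" and Y :: "'b graph"
  assumes X: "is_graph X" and Y: "is_graph Y" and epi: "epi X Y f"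
  shows "f ` parts X = parts Y"
proof
  have f: "hom X Y f" using epi by (simp add: epi_def)
  define S where "S = f ` parts X"
  show "f ` parts X \<subseteq> parts Y" using hom_parts[OF f] by auto
  define c :: "'b \<Rightarrow> 'b + 'b" where "c a = (if a \<in> S then Inl a else Inr a)" for a
  \<comment> \<open>Edges \<open>Inl e\<close> take their ends in the first copy and edges
    \<open>Inr e\<close> through \<open>c\<close>, so an edge outside \<open>S\<close> may end at
    glued vertices.\<close>
  define Z where "Z = \<lparr>verts = Inl ` verts Y \<union> c ` verts Y, edges = Inl ` edges Y \<union> c ` edges Y,
    inc = case_sum (\<lambda>e. map_uprod Inl (inc Y e)) (\<lambda>e. map_uprod c (inc Y e))\<rparr>"
  have sub: "set_uprod (inc Y e) \<subseteq> verts Y" if "e \<in> edges Y" for e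
    using Y that by (auto simp: is_graph_def)
  have disj: "verts Y \<inter> edges Y = {}" using Y by (simp add: is_graph_def)
  have sets: "set_uprod (map_uprod (k :: 'b \<Rightarrow> 'b + 'b) p) = k ` set_uprod p" for k p
    by (cases p) auto
  have Z: "is_graph Z"
    unfolding is_graph_def
  proof (intro conjI ballI)
    show "verts Z \<inter> edges Z = {}"
      using disj by (auto simp: Z_def c_def split: if_splits)
    fix e assume "e \<in> edges Z"
    then show "set_uprod (inc Z e) \<subseteq> verts Z"
      using sub by (fastforce simp: Z_def sets c_def split: if_splits)
  qed
  \<comment> \<open>A glued edge has its ends in the first copy, so \<open>c\<close> can preserve
    incidence only if the ends of edges in \<open>S\<close> are glued too.\<close>
  have ends_S: "set_uprod (inc Y e) \<subseteq> S" if e: "e \<in> edges Y" "e \<in> S" for e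
  proof -
    obtain a where a: "a \<in> parts X" "e = f a" using e by (auto simp: S_def)
    have aE: "a \<in> edges X"
      using a e f disj by (auto simp: parts_def hom_def)
    have "set_uprod (inc X a) \<subseteq> verts X" using X aE by (auto simp: is_graph_def)
    then show ?thesis
      using hom_inc[OF X Y f aE] a by (cases "inc X a") (auto simp: S_def parts_def)
  qed
  have "hom Y Z Inl"
    by (rule homI[OF Y Z]) (auto simp: Z_def)
  moreover have "hom Y Z c"
  proof (rule homI[OF Y Z])
    fix e assume e: "e \<in> edges Y"
    show "inc Z (c e) = map_uprod c (inc Y e)"
    proof (cases "e \<in> S")
      case True
      then have "map_uprod Inl (inc Y e) = map_uprod c (inc Y e)"
        using ends_S[OF e] by (intro map_uprod_cong') (auto simp: c_def)
      then show ?thesis using True by (simp add: Z_def c_def)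
    qed (simp add: Z_def c_def)
  qed (auto simp: Z_def)
  moreover have "eq_hom X (Inl \<circ> f) (c \<circ> f)"
    by (auto simp: eq_hom_def c_def S_def)
  ultimately have "eq_hom Y Inl c"
    using epi Z unfolding epi_def by blast
  then show "parts Y \<subseteq> f ` parts X"
    by (auto simp: eq_hom_def c_def S_def split: if_splits)
qed

section \<open>Criteria for isomorphism\<close>

lemma graph_iso_surj:
  assumes "graph_iso X Y f"
  shows "f ` parts X = parts Y"
proof -
  obtain g where f: "hom X Y f" and g: "hom Y X g" and fg: "eq_hom Y (f \<circ> g) id"
    using assms by (auto simp: graph_iso_def)
  have "y \<in> f ` parts X" if "y \<in> parts Y" for y
    using fg that hom_parts[OF g that] by (auto simp: eq_hom_def intro!: image_eqI[of _ f "g y"])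
  then show ?thesis using hom_parts[OF f] by auto
qed

lemma isomorphic_sym: "isomorphic X Y \<Longrightarrow> isomorphic Y X"
  unfolding isomorphic_def graph_iso_def by blast

lemma bij_hom_imp_graph_iso:
  assumes X: "is_graph X" and Y: "is_graph Y" and f: "hom X Y f" and bij: "bij_betw f (parts X) (parts Y)"
  shows "graph_iso X Y f"
proof -
  define g where "g = inv_into (parts X) f"
  have gf: "g (f a) = a" if "a \<in> parts X" for a
    using bij that by (simp add: g_def bij_betw_def)
  have surj: "f ` parts X = parts Y" using bij by (simp add: bij_betw_def)
  have "hom Y X g"
  proof (rule homI[OF Y X])
    show "g v \<in> verts X" if "v \<in> verts Y" for v
      using that gf unfolding surj_hom_verts[OF Y f surj, symmetric] by (auto simp: parts_def)
    fix e assume "e \<in> edges Y"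
    then obtain a where a: "a \<in> edges X" "e = f a"
      using surj_hom_edges[OF Y f surj] by auto
    then have ge: "g e = a" using gf by (simp add: parts_def)
    then show "g e \<in> edges X" using a by simp
    \<comment> \<open>The ends of \<open>e = f a\<close> are the \<open>f\<close>-images of the ends
      of \<open>a\<close>, and \<open>g\<close> sends them back.\<close>
    have "set_uprod (inc X a) \<subseteq> parts X" using X a by (auto simp: is_graph_def parts_def)
    then show "inc X (g e) = map_uprod g (inc Y e)"
      using hom_inc[OF X Y f a(1)] ge a gf by (cases "inc X a") auto
  qed
  moreover have "eq_hom X (g \<circ> f) id" using gf by (simp add: eq_hom_def)
  moreover have "eq_hom Y (f \<circ> g) id"
    using bij by (auto simp: eq_hom_def g_def bij_betw_def f_inv_into_f)
  ultimately show ?thesis using f by (auto simp: graph_iso_def)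
qed

lemma simple_surj_hom_imp_graph_iso:
  assumes X: "simple_graph X" and Y: "is_graph Y" and f: "hom X Y f"
    and surj: "f ` parts X = parts Y"
    and fin: "finite (verts X)" and card: "card (verts X) = card (verts Y)"
  shows "graph_iso X Y f"
proof -
  have X': "is_graph X" using X by (simp add: simple_graph_def)
  have inj_v: "inj_on f (verts X)"
    using surj_hom_verts[OF Y f surj] fin card by (intro eq_card_imp_inj_on) auto
  \<comment> \<open>Edges with the same image have ends with the same images, hence the same ends by
    \<open>inj_v\<close>; simplicity of \<open>X\<close> then makes them equal.\<close>
  have inj_e: "inj_on f (edges X)"
  proof (rule inj_onI)
    fix d e assume de: "d \<in> edges X" "e \<in> edges X" "f d = f e"
    have "map_uprod f (inc X d) = map_uprod f (inc X e)"
      using hom_inc[OF X' Y f] de by metis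
    moreover have "set_uprod (inc X d) \<subseteq> verts X" "set_uprod (inc X e) \<subseteq> verts X"
      using X' de by (auto simp: is_graph_def)
    ultimately have "inc X d = inc X e"
      using inj_v by (cases "inc X d"; cases "inc X e") (auto dest: inj_onD)
    then show "d = e" using X de by (auto simp: simple_graph_def dest: inj_onD)
  qed
  have "inj_on f (parts X)"
    using inj_v inj_e f Y unfolding parts_def
    by (fastforce simp: inj_on_Un hom_def is_graph_def)
  then show ?thesis
    using surj by (intro bij_hom_imp_graph_iso X' Y f) (simp add: bij_betw_def)
qed

section \<open>Kernel pairs and factorization\<close>

text \<open>
  If \<open>f\<close> identifies two edges, it matches their ends straight or crosswise, so that \<open>EPair\<close> or \<open>EBar\<close>
  of them lies in the kernel pair.
\<close>

lemma kernel_pair_coequalizing: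
  assumes X: "is_graph X" and Y: "is_graph Y" and f: "hom X Y f"
    and d: "eq_hom (equalizer (product X X) (f \<circ> proj0) (f \<circ> proj1)) (d \<circ> proj0) (d \<circ> proj1)"
    and a: "a \<in> parts X" and b: "b \<in> parts X" and eq: "f a = f b"
  shows "d a = d b"
proof -
  let ?P = "product X X"
  let ?R = "equalizer ?P (f \<circ> proj0) (f \<circ> proj1)"
  have P: "is_graph ?P" by (rule is_graph_product[OF X X])
  have dR: "d (proj0 p) = d (proj1 p)" if "p \<in> parts ?R" for p
    using d that by (simp add: eq_hom_def)
  \<comment> \<open>Since \<open>f\<close> preserves kinds and \<open>Y\<close> keeps them disjoint,
    \<open>f a = f b\<close> forces \<open>a\<close> and \<open>b\<close> to be of one kind.\<close>
  consider "a \<in> verts X" "b \<in> verts X" | "a \<in> edges X" "b \<in> edges X"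
    using a b eq f Y by (fastforce simp: parts_def hom_def is_graph_def)
  then show ?thesis
  proof cases
    case 1
    then have v: "VPair a b \<in> verts ?P" by (simp add: product_def)
    then have "VPair a b \<in> parts ?R"
      using eq by (auto simp: equalizer_def Let_def parts_def)
    from dR[OF this] show ?thesis by simp
  next
    case 2
    obtain a1 a2 where la: "labelled_ends X a = (a1, a2)" by fastforce
    obtain b1 b2 where lb: "labelled_ends X b = (b1, b2)" by fastforce
    have ia: "inc X a = Upair a1 a2" and ib: "inc X b = Upair b1 b2"
      using inc_labelled_ends[of X a] inc_labelled_ends[of X b] la lb by auto
    have "Upair (f a1) (f a2) = Upair (f b1) (f b2)"
      using hom_inc[OF X Y f 2(1)] hom_inc[OF X Y f 2(2)] eq ia ib by (metis map_uprod_simps)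
    \<comment> \<open>If \<open>a1 = a2\<close> or \<open>b1 = b2\<close>, a crosswise match is also
      straight. The remaining crosswise case is thus one where \<open>EBar a b\<close>
      exists.\<close>
    then consider (straight) "f a1 = f b1" "f a2 = f b2"
      | (cross) "f a1 = f b2" "f a2 = f b1" "a1 \<noteq> a2" "b1 \<noteq> b2"
      by auto
    then show ?thesis
    proof cases
      case straight
      have e: "EPair a b \<in> edges ?P" using 2 by (simp add: product_def)
      have "inc ?P (EPair a b) = Upair (VPair a1 b1) (VPair a2 b2)"
        by (simp add: product_def la lb)
      then have "EPair a b \<in> parts ?R"
        using e eq straight P by (auto simp: equalizer_def Let_def parts_def)
      from dR[OF this] show ?thesis by simp
    next
      case cross
      have e: "EBar a b \<in> edges ?P" using 2 cross ia ib by (simp add: product_def)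
      have "inc ?P (EBar a b) = Upair (VPair a1 b2) (VPair a2 b1)"
        by (simp add: product_def la lb)
      then have "EBar a b \<in> parts ?R"
        using e eq cross P by (auto simp: equalizer_def Let_def parts_def)
      from dR[OF this] show ?thesis by simp
    qed
  qed
qed

text \<open>By \<open>fibres\<close> the choice of preimage does not matter. Each edge of
  \<open>Y\<close> lifts to an edge of \<open>X\<close>, so incidence can be checked there.\<close>

lemma hom_factor_through_surj:
  assumes X: "is_graph X" and Y: "is_graph Y" and Z: "is_graph Z"
    and f: "hom X Y f" and surj: "f ` parts X = parts Y" and d: "hom X Z d"
    and fibres: "\<And>a b. a \<in> parts X \<Longrightarrow> b \<in> parts X \<Longrightarrow> f a = f b \<Longrightarrow> d a = d b"
  obtains h where "hom Y Z h" "eq_hom X (h \<circ> f) d"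
proof
  define h where "h = d \<circ> inv_into (parts X) f"
  have hf: "h (f a) = d a" if "a \<in> parts X" for a
    using that unfolding h_def comp_def
    by (intro fibres) (auto intro: inv_into_into f_inv_into_f)
  then show "eq_hom X (h \<circ> f) d" by (simp add: eq_hom_def)
  show "hom Y Z h"
  proof (rule homI[OF Y Z])
    show "h v \<in> verts Z" if "v \<in> verts Y" for v
      using that hf d unfolding surj_hom_verts[OF Y f surj, symmetric] by (auto simp: parts_def hom_def)
    fix e assume "e \<in> edges Y"
    then obtain a where a: "a \<in> edges X" "e = f a"
      using surj_hom_edges[OF Y f surj] by auto
    then have he: "h e = d a" using hf by (simp add: parts_def)
    then show "h e \<in> edges Z" using a d by (simp add: hom_def)
    have "set_uprod (inc X a) \<subseteq> parts X" using X a by (auto simp: is_graph_def parts_def)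
    then show "inc Z (h e) = map_uprod h (inc Y e)"
      using hom_inc[OF X Y f a(1)] hom_inc[OF X Z d a(1)] he a hf by (cases "inc X a") auto
  qed
qed

section \<open>Reconstruction from vertex-deleted subgraphs\<close>

lemma part_in_vertex_deleted_subgraph:
  assumes X: "is_graph X" and card: "card (verts X) \<ge> 3"
    and del: "vertex_deleted_subgraphs X I Xs" and a: "a \<in> parts X"
  obtains i where "i \<in> I" "a \<in> parts (Xs i)"
proof -
  obtain v where v: "bij_betw v I (verts X)" and Xs: "\<And>i. i \<in> I \<Longrightarrow> Xs i = delete_vertex X (v i)"
    using del by (auto simp: vertex_deleted_subgraphs_def)
  obtain x y where xy: "ends X a = Upair x y" by (cases "ends X a")
  \<comment> \<open>A part has at most two ends, so one of at least three vertices lies off it, and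
    deleting that vertex \<open>w\<close> keeps the part.\<close>
  have "card {x, y} < card (verts X)"
    using card card_insert_le_m1[of 2 "{y}" x] by simp
  then obtain w where w: "w \<in> verts X" "w \<notin> {x, y}"
    using card_mono[of "{x, y}" "verts X"] by (auto simp: not_le)
  then obtain i where i: "i \<in> I" "w = v i" using v by (auto simp: bij_betw_def)
  have "a \<in> parts (Xs i)"
  proof (cases "a \<in> verts X")
    case True
    then show ?thesis using w xy i Xs by (auto simp: parts_def delete_vertex_def)
  next
    case False
    then show ?thesis using a w xy i Xs X by (auto simp: parts_def delete_vertex_def)
  qed
  with i(1) that show ?thesis by blast
qed

theorem mainTheorem5:
  fixes G :: "'a graph" and H :: "'b graph" and I :: "'i set"
    and Gs :: "'i \<Rightarrow> 'a graph" and Hs :: "'i \<Rightarrow> 'b graph"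
    and \<gamma> :: "'i \<Rightarrow> 'a \<Rightarrow> 'b" and \<kappa> :: "'i \<Rightarrow> 'b \<Rightarrow> 'b"
    and C :: "('i \<times> 'a) graph" and \<Gamma> :: "'i \<times> 'a \<Rightarrow> 'b"
    and P R :: "('i \<times> 'a, 'i \<times> 'a) product_part graph"
    and p0 p1 :: "('i \<times> 'a, 'i \<times> 'a) product_part \<Rightarrow> 'i \<times> 'a"
    and k :: "('i \<times> 'a, 'i \<times> 'a) product_part \<Rightarrow> ('i \<times> 'a, 'i \<times> 'a) product_part"
  assumes "simple_graph G" and "finite_graph G" and "card (verts G) \<ge> 3"
    and "simple_graph H" and "finite_graph H" and "card (verts H) \<ge> 3"
    and "vertex_deleted_subgraphs G I Gs" and "vertex_deleted_subgraphs H I Hs"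
    and "\<And>i. i \<in> I \<Longrightarrow> graph_iso (Gs i) (Hs i) (\<gamma> i)"
    and "\<And>i. i \<in> I \<Longrightarrow> \<kappa> i = id"
    and "C = coproduct I Gs"
    and "hom C H \<Gamma>" and "\<And>i. i \<in> I \<Longrightarrow> eq_hom (Gs i) (\<Gamma> \<circ> coproj i) (\<kappa> i \<circ> \<gamma> i)"
    and "P = product C C" and "p0 = proj0" and "p1 = proj1"
    and "R = equalizer P (\<Gamma> \<circ> p0) (\<Gamma> \<circ> p1)" and "k = id"
  shows "isomorphic G H \<longleftrightarrow> (\<exists>\<delta>. epi C G \<delta> \<and> eq_hom R (\<delta> \<circ> p0 \<circ> k) (\<delta> \<circ> p1 \<circ> k))"
proof -
  have G: "is_graph G" and H: "is_graph H"
    using assms(1,4) by (auto simp: simple_graph_def)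
  have "is_graph (Gs i)" if "i \<in> I" for i
    using assms(7) that is_graph_delete_vertex[OF G] by (auto simp: vertex_deleted_subgraphs_def)
  then have C: "is_graph C"
    unfolding assms(11) by (rule is_graph_coproduct)
  have \<Gamma>: "hom C H \<Gamma>" by fact
  have "y \<in> \<Gamma> ` parts C" if y: "y \<in> parts H" for y
  proof -
    obtain i where i: "i \<in> I" "y \<in> parts (Hs i)"
      using part_in_vertex_deleted_subgraph[OF H assms(6,8) y] .
    then obtain x where x: "x \<in> parts (Gs i)" "y = \<gamma> i x"
      using graph_iso_surj[OF assms(9)] by blast
    \<comment> \<open>As \<open>\<kappa> i\<close> is the identity, \<Gamma> acts on the summand
      \<open>i\<close> as \<open>\<gamma> i\<close>.\<close>
    then have "\<Gamma> (i, x) = y"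
      using assms(10,13)[OF i(1)] by (simp add: eq_hom_def coproj_def)
    moreover have "(i, x) \<in> parts C"
      using x i by (auto simp: assms(11) coproduct_def parts_def)
    ultimately show ?thesis by blast
  qed
  then have surj: "\<Gamma> ` parts C = parts H" using hom_parts[OF \<Gamma>] by auto
  show ?thesis
  proof
    assume "isomorphic G H"
    then obtain \<epsilon> where \<epsilon>: "graph_iso H G \<epsilon>"
      using isomorphic_sym unfolding isomorphic_def by blast
    have "hom C G (\<epsilon> \<circ> \<Gamma>)"
      using hom_comp[OF C H G \<Gamma>] \<epsilon> by (auto simp: graph_iso_def)
    moreover have "(\<epsilon> \<circ> \<Gamma>) ` parts C = parts G"
      using surj graph_iso_surj[OF \<epsilon>] by (metis image_comp)
    ultimately have "epi C G (\<epsilon> \<circ> \<Gamma>)" by (rule surj_hom_imp_epi)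
    \<comment> \<open>The legs of \<open>R\<close> already agree after \<Gamma>, hence also after
      \<epsilon> is applied on top.\<close>
    moreover have "eq_hom R (\<Gamma> \<circ> p0 \<circ> k) (\<Gamma> \<circ> p1 \<circ> k)"
      using hom_equalizer(2)[OF is_graph_product[OF C C]] assms(14-18) by simp
    then have "eq_hom R (\<epsilon> \<circ> \<Gamma> \<circ> p0 \<circ> k) (\<epsilon> \<circ> \<Gamma> \<circ> p1 \<circ> k)"
      by (simp add: eq_hom_def)
    ultimately show "\<exists>\<delta>. epi C G \<delta> \<and> eq_hom R (\<delta> \<circ> p0 \<circ> k) (\<delta> \<circ> p1 \<circ> k)" by blast
  next
    assume "\<exists>\<delta>. epi C G \<delta> \<and> eq_hom R (\<delta> \<circ> p0 \<circ> k) (\<delta> \<circ> p1 \<circ> k)"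
    then obtain \<delta> where epi: "epi C G \<delta>"
      and "eq_hom R (\<delta> \<circ> p0 \<circ> k) (\<delta> \<circ> p1 \<circ> k)" by blast
    then have coeq: "eq_hom (equalizer (product C C) (\<Gamma> \<circ> proj0) (\<Gamma> \<circ> proj1)) (\<delta> \<circ> proj0) (\<delta> \<circ> proj1)"
      using assms(14-18) by simp
    have \<delta>: "hom C G \<delta>" using epi by (simp add: epi_def)
    obtain \<epsilon> where \<epsilon>: "hom H G \<epsilon>" and \<epsilon>\<Gamma>: "eq_hom C (\<epsilon> \<circ> \<Gamma>) \<delta>"
      using hom_factor_through_surj[OF C H G \<Gamma> surj \<delta> kernel_pair_coequalizing[OF C H \<Gamma> coeq]] .
    \<comment> \<open>Since \<Gamma> is onto, \<epsilon> has the same image as \<delta>, which is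
      all of \<open>G\<close> because \<delta> is epi.\<close>
    have "\<epsilon> ` parts H = \<delta> ` parts C"
      using \<epsilon>\<Gamma> unfolding surj[symmetric] eq_hom_def image_image by (intro image_cong) auto
    then have surj_\<epsilon>: "\<epsilon> ` parts H = parts G"
      using epi_imp_surj[OF C G epi] by simp
    \<comment> \<open>Both vertex sets are in bijection with the common index set
      \<open>I\<close>.\<close>
    have "card (verts H) = card (verts G)"
      using assms(7,8) unfolding vertex_deleted_subgraphs_def by (metis bij_betw_same_card)
    then have "graph_iso H G \<epsilon>"
      using assms(4,5) G \<epsilon> surj_\<epsilon>
      by (intro simple_surj_hom_imp_graph_iso) (auto simp: finite_graph_def)
    then show "isomorphic G H"
      using isomorphic_sym unfolding isomorphic_def by blast
  qed
qed

end
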